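(* For every $\epsilon>0$ there is a constant $C(\epsilon)>0$, depending on $\epsilon$ alone, such that for every sequence of complex numbers $\{a_n\}$, every positive integer $Q$, and all integers $M,N$ with $N>0$, $$\sum_{q=1}^Q \sum_{\substack{a \bmod q^2 \\ \gcd(a,q)=1}} \left| \sum_{n=M+1}^{M+N} a_n\, e\!\left( \frac{a}{q^2} n \right) \right|^2 \le C(\epsilon)\, \log (2Q) \left[ Q^3+ \left(N\sqrt{Q} +\sqrt{N}\,Q^2\right)N^{\epsilon} \right] \sum_{n=M+1}^{M+N} |a_n|^2 .$$
   Context: $e(z)=\exp(2\pi i z)$. The sum over $a \bmod q^2$ with $\gcd(a,q)=1$ runs over a set of representatives of the residue classes modulo $q^2$ that are coprime to $q$. *)

theory Defs
  imports Complex_Main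
begin

definition e :: "complex \<Rightarrow> complex" where
  "e z = exp (2 * complex_of_real pi * \<i> * z)"

(* The residue classes modulo q^2 coprime to q, by their least nonnegative representatives.
   For q = 1 this is {0}, since coprime 0 1 holds. *)
definition coprime_residues_sq :: "nat \<Rightarrow> nat set" where
  "coprime_residues_sq q = {r. r < q ^ 2 \<and> coprime r q}"

end

theory Submission
  imports Defs "HOL-Analysis.Analysis" "HOL-Computational_Algebra.Primes"
begin

text \<open>
  By duality, the large sieve reduces to counting, for a fixed fraction b/r^2, the fractions a/q^2
  within distance \<open>\<Delta> \<ge> 1/N\<close> of it modulo 1. Restrict q and r to a dyadic block [P, 2P).
  If \<open>8 P^2 \<Delta> \<ge> 1\<close>, the trivial bound \<open>O(P^3 \<Delta>)\<close> suffices. Otherwise each q carries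
  at most one close fraction, and if it carries any, then b q^2 lies within \<open>16 P^4 \<Delta>\<close> of a
  multiple of r^2. For two such q, q' the difference m = q^2 - q'^2 < 4 P^2 has b m within
  \<open>32 P^4 \<Delta>\<close> of a multiple of r^2, which leaves \<open>O(1 + P^4 \<Delta>)\<close> values of m as b is coprime
  to r, and m determines (q, q') up to a divisor q - q' of m. By the divisor bound, the square of
  the number of such q is \<open>O(N^\<epsilon> (1 + P^4 \<Delta>))\<close>. This gives
  \<open>P^3 + (N + sqrt N P^2) N^\<epsilon>\<close> for each block, and there are at most log (2Q) / log 2 blocks.
\<close>

subsection \<open>The large sieve\<close>

text \<open>This is the condition that the distance from \<open>x\<close> to the nearest integer is
  at most \<open>\<delta>\<close>, with the integer kept as a witness for the counting
  arguments.\<close>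

definition near_int :: "real \<Rightarrow> real \<Rightarrow> bool" where
  "near_int \<delta> x \<longleftrightarrow> (\<exists>k::int. \<bar>x - of_int k\<bar> \<le> \<delta>)"

text \<open>A Dirichlet-type kernel, written in powers of a single number so that the geometric sum
  formula applies.\<close>

definition exp_sum :: "nat \<Rightarrow> real \<Rightarrow> complex" where
  "exp_sum L x = (\<Sum>k<L. cis (2 * pi * x) ^ k)"

lemma e_eq_cis: "e (of_real x) = cis (2 * pi * x)"
  by (simp add: e_def cis_conv_exp mult_ac)

text \<open>A weak Jordan inequality: the Taylor error is at most x^3 / 6, and pi / 2 < 1.6 gives
  x^2 < 3, so the error is at most x / 2.\<close>

lemma sin_ge_half:
  fixes x :: real
  assumes "0 \<le> x" "x \<le> pi / 2"
  shows "x / 2 \<le> sin x"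
proof -
  have eq: "(\<Sum>m<3. sin_coeff m * x ^ m) = x"
    by (simp add: eval_nat_numeral sin_coeff_def)
  have "\<bar>sin x - x\<bar> \<le> \<bar>x\<bar> ^ 3 / 6"
    using Maclaurin_sin_bound[of x 3] unfolding eq by (simp add: eval_nat_numeral)
  moreover have "x ^ 2 \<le> 1.6 ^ 2"
    using assms pi_less_4 pi_approx by (intro power_mono) auto
  then have "x * x ^ 2 \<le> x * 3"
    using assms by (intro mult_left_mono) (auto simp: power2_eq_square)
  then have "\<bar>x\<bar> ^ 3 / 6 \<le> x / 2"
    using assms by (simp add: eval_nat_numeral)
  ultimately show ?thesis by linarith
qed

text \<open>With t the signed distance to the nearest integer, the chord has length 2 |sin (pi t)|.
  Since pi > 2, the factor 1/2 lost in \<open>sin_ge_half\<close> is absorbed.\<close>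

lemma norm_cis_minus_1_ge:
  assumes "\<not> near_int \<eta> x"
  shows "2 * \<eta> \<le> cmod (cis (2 * pi * x) - 1)"
proof -
  define t where "t = x - of_int (round x)"
  have t: "\<bar>t\<bar> \<le> 1 / 2"
    unfolding t_def using of_int_round_abs_le[of x] by (simp add: abs_minus_commute)
  have "\<eta> < \<bar>t\<bar>" using assms by (auto simp: near_int_def t_def not_le)
  also have "\<bar>t\<bar> = 2 * \<bar>t\<bar> / 2" by simp
  also have "\<dots> \<le> (pi * \<bar>t\<bar>) / 2"
    using pi_gt3 by (intro divide_right_mono mult_right_mono) auto
  also have "\<dots> \<le> sin (pi * \<bar>t\<bar>)"
    using t by (intro sin_ge_half) auto
  also have "\<dots> \<le> \<bar>sin (pi * t)\<bar>" by (cases "t \<ge> 0") auto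
  finally have "\<eta> \<le> \<bar>sin (2 * pi * t / 2)\<bar>" by simp
  moreover have "cis (2 * pi * x) = cis (2 * pi * t)"
  proof -
    have "cis (2 * pi * x) = cis (2 * pi * t + 2 * pi * of_int (round x))"
      by (simp add: t_def algebra_simps)
    also have "\<dots> = cis (2 * pi * t)"
      unfolding cis_mult[symmetric] by (simp add: cis_multiple_2pi)
    finally show ?thesis .
  qed
  moreover have "cmod (cis (2 * pi * t) - 1) = 2 * \<bar>sin (2 * pi * t / 2)\<bar>"
    using dist_exp_i_1[of "2 * pi * t"] by (simp add: cis_conv_exp)
  ultimately show ?thesis by simp
qed

lemma norm_exp_sum_le: "cmod (exp_sum L x) \<le> real L"
  unfolding exp_sum_def
  by (rule order_trans[OF norm_sum]) (simp add: norm_power)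

lemma norm_exp_sum_le_inverse:
  assumes "\<not> near_int \<eta> x" "\<eta> > 0"
  shows "cmod (exp_sum L x) \<le> 1 / \<eta>"
proof -
  let ?z = "cis (2 * pi * x)"
  have ge: "2 * \<eta> \<le> cmod (?z - 1)" by (rule norm_cis_minus_1_ge) fact
  then have "?z \<noteq> 1" using assms by auto
  then have "cmod (exp_sum L x) = cmod (?z ^ L - 1) / cmod (?z - 1)"
    unfolding exp_sum_def by (subst geometric_sum) (auto simp: norm_divide)
  also have "\<dots> \<le> 2 / (2 * \<eta>)"
    using ge assms(2) norm_triangle_ineq4[of "?z ^ L" 1]
    by (intro frac_le) (auto simp: norm_power)
  finally show ?thesis using assms by simp
qed

lemma norm_exp_sum_minus: "cmod (exp_sum L (- x)) = cmod (exp_sum L x)"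
proof -
  have "exp_sum L (- x) = cnj (exp_sum L x)"
    by (simp add: exp_sum_def flip: cis_cnj)
  then show ?thesis by simp
qed

text \<open>The smallest shell containing x already accounts for the product. Using a sum of
  indicators over all shells allows the order of summation to be exchanged later, which turns row
  sums into point counts.\<close>

lemma norm_exp_sum_mult_le:
  assumes "N > 0"
  shows "cmod (exp_sum (2 * N) x) * cmod (exp_sum N x)
    \<le> (\<Sum>i\<le>N. if near_int (2 ^ i / real N) x then 4 * real N ^ 2 / 4 ^ i else 0)"
    (is "?G \<le> sum ?f _")
proof -
  \<comment> \<open>The radius is at least 1 at i = N, so every x lies in some shell and the
    \<open>LEAST\<close> below exists.\<close>
  have "near_int (2 ^ N / real N) x"
  proof -
    have "real N \<le> 2 ^ N" by (metis less_exp of_nat_less_iff of_nat_numeral of_nat_power order_less_imp_le)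
    then have "1 \<le> 2 ^ N / real N" using assms by simp
    then have "\<bar>x - of_int (round x)\<bar> \<le> 2 ^ N / real N"
      using of_int_round_abs_le[of x] by (simp add: abs_minus_commute)
    then show ?thesis unfolding near_int_def by blast
  qed
  define i where "i = (LEAST i. near_int (2 ^ i / real N) x)"
  have i: "near_int (2 ^ i / real N) x" "i \<le> N"
    unfolding i_def using \<open>near_int (2 ^ N / real N) x\<close> by (auto intro: LeastI Least_le)
  have "?G \<le> 4 * real N ^ 2 / 4 ^ i"
  proof (cases i)
    case 0
    have "?G \<le> real (2 * N) * real N" by (intro mult_mono norm_exp_sum_le) auto
    also have "\<dots> \<le> 4 * (real N * real N)" by simp
    finally show ?thesis using 0 by (simp add: power2_eq_square)
  next
    case (Suc j)
    \<comment> \<open>By minimality x lies outside the previous shell, so each factor is at most N /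
      2^j; the 4 in the bound pays for the index shift from j to i.\<close>
    then have nn: "\<not> near_int (2 ^ j / real N) x"
      using not_less_Least[of j "\<lambda>i. near_int (2 ^ i / real N) x"] i_def by auto
    then have "?G \<le> (1 / (2 ^ j / real N)) * (1 / (2 ^ j / real N))"
      using assms by (intro mult_mono norm_exp_sum_le_inverse) auto
    also have "\<dots> = real N ^ 2 / (2 ^ 2) ^ j"
      unfolding power_mult[symmetric] mult_2 by (simp add: power2_eq_square power_add)
    finally show ?thesis using Suc by simp
  qed
  also have "\<dots> = ?f i" using i by simp
  also have "\<dots> \<le> sum ?f {..N}" using i by (intro member_le_sum) auto
  finally show ?thesis .
qed

section \<open>Schur test, duality and the smoothed large sieve\<close>

lemma Schur_bound:
  fixes c :: "'r \<Rightarrow> real" and G :: "'r \<Rightarrow> 'r \<Rightarrow> real"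
  assumes nonneg: "\<And>r s. G r s \<ge> 0" and sym: "\<And>r s. G r s = G s r"
    and row: "\<And>r. r \<in> R \<Longrightarrow> (\<Sum>s\<in>R. G r s) \<le> B"
  shows "(\<Sum>r\<in>R. \<Sum>s\<in>R. c r * c s * G r s) \<le> B * (\<Sum>r\<in>R. c r ^ 2)"
proof -
  have "(\<Sum>r\<in>R. \<Sum>s\<in>R. c r * c s * G r s)
      \<le> (\<Sum>r\<in>R. \<Sum>s\<in>R. (c r ^ 2 * G r s + c s ^ 2 * G r s) / 2)"
  proof (intro sum_mono)
    fix r s
    have "c r * c s \<le> (c r ^ 2 + c s ^ 2) / 2"
      using sum_squares_bound[of "c r" "c s"] by simp
    then have "c r * c s * G r s \<le> (c r ^ 2 + c s ^ 2) / 2 * G r s"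
      using nonneg by (intro mult_right_mono)
    then show "c r * c s * G r s \<le> (c r ^ 2 * G r s + c s ^ 2 * G r s) / 2"
      by (simp add: field_simps)
  qed
  also have "\<dots> = ((\<Sum>r\<in>R. \<Sum>s\<in>R. c r ^ 2 * G r s) + (\<Sum>r\<in>R. \<Sum>s\<in>R. c s ^ 2 * G r s)) / 2"
    by (simp add: sum.distrib flip: sum_divide_distrib)
  \<comment> \<open>After the arithmetic-geometric mean inequality, symmetry of \<open>G\<close>
    makes both halves equal, so bounding rows suffices.\<close>
  also have "(\<Sum>r\<in>R. \<Sum>s\<in>R. c s ^ 2 * G r s) = (\<Sum>r\<in>R. \<Sum>s\<in>R. c r ^ 2 * G r s)"
    by (subst sum.swap) (simp add: sym)
  also have "((\<Sum>r\<in>R. \<Sum>s\<in>R. c r ^ 2 * G r s) + (\<Sum>r\<in>R. \<Sum>s\<in>R. c r ^ 2 * G r s)) / 2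
      = (\<Sum>r\<in>R. c r ^ 2 * (\<Sum>s\<in>R. G r s))"
    by (simp only: sum_distrib_left[symmetric]) simp
  also have "\<dots> \<le> (\<Sum>r\<in>R. c r ^ 2 * B)"
    using row by (intro sum_mono mult_left_mono) auto
  finally show ?thesis by (simp add: sum_distrib_left mult.commute)
qed

text \<open>Testing the dual inequality on the conjugates of the sums \<open>T r\<close> themselves
  writes S as a sum of \<open>a n * U n\<close>. Cauchy-Schwarz then gives S^2 \<le> Z B S, and S
  cancels unless it vanishes.\<close>

lemma duality:
  fixes x :: "'r \<Rightarrow> 'n \<Rightarrow> complex"
  assumes "B \<ge> 0"
    and dual: "\<And>c :: 'r \<Rightarrow> complex. (\<Sum>n\<in>I. cmod (\<Sum>r\<in>R. c r * x r n) ^ 2) \<le> B * (\<Sum>r\<in>R. cmod (c r) ^ 2)"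
  shows "(\<Sum>r\<in>R. cmod (\<Sum>n\<in>I. a n * x r n) ^ 2) \<le> B * (\<Sum>n\<in>I. cmod (a n) ^ 2)"
proof -
  define T where "T r = (\<Sum>n\<in>I. a n * x r n)" for r
  define S where "S = (\<Sum>r\<in>R. cmod (T r) ^ 2)"
  define Z where "Z = (\<Sum>n\<in>I. cmod (a n) ^ 2)"
  define U where "U n = (\<Sum>r\<in>R. cnj (T r) * x r n)" for n
  have nn: "S \<ge> 0" "Z \<ge> 0" by (auto simp: S_def Z_def intro: sum_nonneg)
  have "of_real S = (\<Sum>r\<in>R. cnj (T r) * T r)"
    by (simp add: S_def complex_norm_square[symmetric] mult.commute del: of_real_power)
  also have "\<dots> = (\<Sum>r\<in>R. \<Sum>n\<in>I. a n * (cnj (T r) * x r n))"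
    by (subst (2) T_def) (simp add: sum_distrib_left mult_ac)
  also have "\<dots> = (\<Sum>n\<in>I. a n * U n)"
    by (subst sum.swap) (simp add: sum_distrib_left U_def)
  finally have "S = cmod (\<Sum>n\<in>I. a n * U n)"
    using nn by (metis norm_of_real abs_of_nonneg)
  also have "\<dots> \<le> (\<Sum>n\<in>I. cmod (a n) * cmod (U n))"
    by (rule order_trans[OF norm_sum]) (simp add: norm_mult)
  finally have "S \<le> (\<Sum>n\<in>I. cmod (a n) * cmod (U n))" .
  then have "S ^ 2 \<le> (\<Sum>n\<in>I. cmod (a n) * cmod (U n)) ^ 2"
    using nn by (intro power_mono)
  also have "\<dots> \<le> Z * (\<Sum>n\<in>I. cmod (U n) ^ 2)"
    unfolding Z_def by (rule Cauchy_Schwarz_ineq_sum)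
  also have "\<dots> \<le> Z * (B * S)"
    using dual[of "\<lambda>r. cnj (T r)"] nn unfolding U_def S_def
    by (intro mult_left_mono) auto
  finally have *: "S * S \<le> (B * Z) * S" by (simp add: power2_eq_square mult_ac)
  show ?thesis
  proof (cases "S = 0")
    case True
    have "0 \<le> B * Z" using assms(1) nn by simp
    then show ?thesis using True by (simp add: S_def T_def Z_def)
  next
    case False
    with nn * have "S \<le> B * Z" by (simp add: mult_le_cancel_right)
    then show ?thesis by (simp add: S_def T_def Z_def)
  qed
qed


text \<open>The longer window starts l places early and has length 2N, so for l < N it still reaches
  beyond M + N; the extra terms are nonnegative.\<close>

lemma window_sum_le:
  fixes g :: "int \<Rightarrow> real"
  assumes "\<And>n. g n \<ge> 0" "l < N"
  shows "(\<Sum>n = M + 1..M + int N. g n) \<le> (\<Sum>k<2 * N. g (M + 1 + int k - int l))"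
proof -
  let ?h = "\<lambda>k. M + 1 + int k - int l"
  have "(\<Sum>k<2 * N. g (?h k)) = sum g (?h ` {..<2 * N})"
    by (subst sum.reindex) (auto simp: inj_on_def)
  moreover have "sum g {M + 1..M + int N} \<le> sum g (?h ` {..<2 * N})"
  proof (intro sum_mono2 subsetI)
    fix n assume n: "n \<in> {M + 1..M + int N}"
    show "n \<in> ?h ` {..<2 * N}"
      by (rule image_eqI[of _ _ "nat (n - M - 1 + int l)"]) (use n assms in auto)
  qed (use assms in auto)
  ultimately show ?thesis by simp
qed

text \<open>
  Averaging over the N windows of length 2N that contain [M + 1, M + N] smooths the sum: the
  resulting kernel \<open>exp_sum (2 * N) \<theta> * exp_sum N (- \<theta>)\<close> decays quadratically in the distance of
  \<open>\<theta>\<close> to the integers, so the dyadic shells of radius \<open>2 ^ i / N\<close> contribute a geometric series.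
\<close>

lemma dual_large_sieve:
  fixes \<alpha> :: "'r \<Rightarrow> real"
  assumes "finite R" "N > 0"
    and card: "\<And>r i. r \<in> R \<Longrightarrow> real (card {s \<in> R. near_int (2 ^ i / real N) (\<alpha> r - \<alpha> s)}) \<le> 2 ^ i * K"
    and "K \<ge> 0"
  shows "(\<Sum>n = M + 1..M + int N. cmod (\<Sum>r\<in>R. c r * cis (2 * pi * \<alpha> r * of_int n)) ^ 2)
      \<le> 8 * N * K * (\<Sum>r\<in>R. cmod (c r) ^ 2)"
proof -
  define g where "g n = cmod (\<Sum>r\<in>R. c r * cis (2 * pi * \<alpha> r * of_int n)) ^ 2" for n :: int
  define G where "G r s = cmod (exp_sum (2 * N) (\<alpha> r - \<alpha> s)) * cmod (exp_sum N (\<alpha> r - \<alpha> s))" for r s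
  have sym: "G r s = G s r" for r s
    unfolding G_def using norm_exp_sum_minus[of _ "\<alpha> r - \<alpha> s"] by simp
  have row: "(\<Sum>s\<in>R. G r s) \<le> 8 * N ^ 2 * K" if "r \<in> R" for r
  proof -
    let ?P = "\<lambda>i s. near_int (2 ^ i / real N) (\<alpha> r - \<alpha> s)"
    have "(\<Sum>s\<in>R. G r s) \<le> (\<Sum>s\<in>R. \<Sum>i\<le>N. if ?P i s then 4 * real N ^ 2 / 4 ^ i else 0)"
      unfolding G_def by (intro sum_mono norm_exp_sum_mult_le assms)
    also have "\<dots> = (\<Sum>i\<le>N. \<Sum>s\<in>R. if ?P i s then 4 * real N ^ 2 / 4 ^ i else 0)"
      by (rule sum.swap)
    also have "\<dots> = (\<Sum>i\<le>N. 4 * real N ^ 2 / 4 ^ i * card {s \<in> R. ?P i s})"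
      using \<open>finite R\<close> by (simp add: sum.If_cases Int_def mult.commute)
    also have "\<dots> \<le> (\<Sum>i\<le>N. 4 * real N ^ 2 / 4 ^ i * (2 ^ i * K))"
      using that by (intro sum_mono mult_left_mono card) auto
    \<comment> \<open>The decay 4^(-i) of the kernel beats the growth 2^i of the count, leaving a
      geometric series of ratio 1/2 and sum at most 2.\<close>
    also have "\<dots> = 4 * real N ^ 2 * K * (\<Sum>i\<le>N. (1 / 2) ^ i)"
      unfolding sum_distrib_left
    proof (intro sum.cong refl)
      fix i
      have "(4::real) ^ i = 2 ^ i * 2 ^ i" by (simp flip: power_mult_distrib)
      then show "4 * real N ^ 2 / 4 ^ i * (2 ^ i * K) = 4 * real N ^ 2 * K * (1 / 2) ^ i"
        by (simp add: power_divide)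
    qed
    also have "(\<Sum>i\<le>N. (1 / 2) ^ i) \<le> (2 :: real)"
    proof -
      have "(\<Sum>i<Suc N. (1 / 2) ^ i) \<le> (\<Sum>i. (1 / 2 :: real) ^ i)"
        by (intro sum_le_suminf) auto
      then show ?thesis by (simp add: suminf_geometric lessThan_Suc_atMost)
    qed
    also have "4 * real N ^ 2 * K * 2 = 8 * N ^ 2 * K" by simp
    finally show ?thesis using \<open>K \<ge> 0\<close> by (simp add: mult_left_mono)
  qed
  have expand: "of_real (\<Sum>l<N. \<Sum>k<2 * N. g (M + 1 + int k - int l)) =
     (\<Sum>r\<in>R. \<Sum>s\<in>R. c r * cnj (c s) * cis (2 * pi * (\<alpha> r - \<alpha> s) * of_int (M + 1))
         * exp_sum (2 * N) (\<alpha> r - \<alpha> s) * exp_sum N (- (\<alpha> r - \<alpha> s)))" (is "_ = ?rhs")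
  proof -
    \<comment> \<open>Opening the square, k and l enter the phase of the pair (r, s) with opposite
      signs, so it factors; summing over k and l produces the two kernels separately.\<close>
    have phase: "(c\<^sub>1 * cis (2 * pi * x * of_int (M + 1 + int k - int l)))
          * cnj (c\<^sub>2 * cis (2 * pi * y * of_int (M + 1 + int k - int l)))
       = c\<^sub>1 * cnj c\<^sub>2 * cis (2 * pi * (x - y) * of_int (M + 1))
          * cis (2 * pi * (x - y)) ^ k * cis (2 * pi * (- (x - y))) ^ l"
      for x y k l c\<^sub>1 c\<^sub>2
    proof -
      have "cis (2 * pi * x * of_int (M + 1 + int k - int l))
          * cnj (cis (2 * pi * y * of_int (M + 1 + int k - int l)))
        = cis (2 * pi * (x - y) * of_int (M + 1))
          * (cis (2 * pi * (x - y)) ^ k * cis (2 * pi * (- (x - y))) ^ l)"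
        unfolding cis_cnj Complex.DeMoivre cis_mult
        by (rule arg_cong[where f = cis]) (simp add: algebra_simps)
      then show ?thesis by (simp only: complex_cnj_mult mult_ac)
    qed
    have "of_real (g (M + 1 + int k - int l)) =
       (\<Sum>r\<in>R. \<Sum>s\<in>R. c r * cnj (c s) * cis (2 * pi * (\<alpha> r - \<alpha> s) * of_int (M + 1))
         * cis (2 * pi * (\<alpha> r - \<alpha> s)) ^ k * cis (2 * pi * (- (\<alpha> r - \<alpha> s))) ^ l)" for k l
      unfolding g_def complex_norm_square cnj_sum sum_product
      by (intro sum.cong refl phase)
    then have "of_real (\<Sum>l<N. \<Sum>k<2 * N. g (M + 1 + int k - int l)) =
       (\<Sum>l<N. \<Sum>k<2 * N. \<Sum>r\<in>R. \<Sum>s\<in>R. c r * cnj (c s) * cis (2 * pi * (\<alpha> r - \<alpha> s) * of_int (M + 1))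
         * cis (2 * pi * (\<alpha> r - \<alpha> s)) ^ k * cis (2 * pi * (- (\<alpha> r - \<alpha> s))) ^ l)"
      by simp
    also have "\<dots> = (\<Sum>l<N. \<Sum>r\<in>R. \<Sum>k<2 * N. \<Sum>s\<in>R. c r * cnj (c s) * cis (2 * pi * (\<alpha> r - \<alpha> s) * of_int (M + 1))
         * cis (2 * pi * (\<alpha> r - \<alpha> s)) ^ k * cis (2 * pi * (- (\<alpha> r - \<alpha> s))) ^ l)"
      by (intro sum.cong refl sum.swap)
    also have "\<dots> = (\<Sum>r\<in>R. \<Sum>l<N. \<Sum>s\<in>R. \<Sum>k<2 * N. c r * cnj (c s) * cis (2 * pi * (\<alpha> r - \<alpha> s) * of_int (M + 1))
         * cis (2 * pi * (\<alpha> r - \<alpha> s)) ^ k * cis (2 * pi * (- (\<alpha> r - \<alpha> s))) ^ l)"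
      by (subst sum.swap) (intro sum.cong refl sum.swap)
    also have "\<dots> = (\<Sum>r\<in>R. \<Sum>s\<in>R. \<Sum>l<N. \<Sum>k<2 * N. c r * cnj (c s) * cis (2 * pi * (\<alpha> r - \<alpha> s) * of_int (M + 1))
         * cis (2 * pi * (\<alpha> r - \<alpha> s)) ^ k * cis (2 * pi * (- (\<alpha> r - \<alpha> s))) ^ l)"
      by (intro sum.cong refl sum.swap)
    also have "\<dots> = ?rhs"
      unfolding exp_sum_def by (simp only: sum_distrib_left sum_distrib_right mult.assoc)
    finally show ?thesis .
  qed
  \<comment> \<open>Each of the N windows dominates the original sum, so the average gains a factor
    N that cancels one power of the N^2 in the row bound.\<close>
  have "real N * (\<Sum>n = M + 1..M + int N. g n) = (\<Sum>l<N. \<Sum>n = M + 1..M + int N. g n)"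
    by simp
  also have "\<dots> \<le> (\<Sum>l<N. \<Sum>k<2 * N. g (M + 1 + int k - int l))"
    by (intro sum_mono window_sum_le) (auto simp: g_def)
  also have "\<dots> = cmod (of_real (\<Sum>l<N. \<Sum>k<2 * N. g (M + 1 + int k - int l)))"
    by (subst norm_of_real, rule abs_of_nonneg[symmetric]) (auto simp: g_def intro!: sum_nonneg)
  also have "\<dots> \<le> (\<Sum>r\<in>R. \<Sum>s\<in>R. cmod (c r) * cmod (c s) * G r s)"
    unfolding expand
    by (intro sum_norm_le) (simp add: norm_mult G_def norm_exp_sum_minus[of N "\<alpha> _ - \<alpha> _", simplified])
  also have "\<dots> \<le> 8 * N ^ 2 * K * (\<Sum>r\<in>R. cmod (c r) ^ 2)"
    by (rule Schur_bound[OF _ sym row]) (simp_all add: G_def)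
  finally have "real N * (\<Sum>n = M + 1..M + int N. g n) \<le> real N * (8 * N * K * (\<Sum>r\<in>R. cmod (c r) ^ 2))"
    by (simp add: power2_eq_square mult_ac)
  then show ?thesis using \<open>N > 0\<close> by (simp add: g_def)
qed

text \<open>\<open>K\<close> bounds the number of points within 1 / N of a given one modulo 1, and
  the count may grow linearly with the radius. Through duality the problem depends only on this
  spacing.\<close>

theorem large_sieve:
  fixes \<alpha> :: "'r \<Rightarrow> real"
  assumes "finite R" "N > 0"
    and "\<And>r i. r \<in> R \<Longrightarrow> real (card {s \<in> R. near_int (2 ^ i / real N) (\<alpha> r - \<alpha> s)}) \<le> 2 ^ i * K"
    and "K \<ge> 0"
  shows "(\<Sum>r\<in>R. cmod (\<Sum>n = M + 1..M + int N. a n * e (of_real (\<alpha> r) * of_int n)) ^ 2)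
      \<le> 8 * N * K * (\<Sum>n = M + 1..M + int N. cmod (a n) ^ 2)"
proof -
  have "e (of_real (\<alpha> r) * of_int n) = cis (2 * pi * \<alpha> r * of_int n)" for r n
    using e_eq_cis[of "\<alpha> r * of_int n"] by (simp add: mult_ac)
  then show ?thesis
    using duality[OF _ dual_large_sieve[OF assms]] \<open>K \<ge> 0\<close> by simp
qed

subsection \<open>The divisor bound\<close>

lemma card_divisors_mult_le:
  fixes a b :: nat
  assumes "a > 0" "b > 0"
  shows "card {d. d dvd a * b} \<le> card {d. d dvd a} * card {d. d dvd b}"
proof -
  have "{d. d dvd a * b} \<subseteq> (\<lambda>(x, y). x * y) ` ({d. d dvd a} \<times> {d. d dvd b})"
    by (auto dest!: division_decomp)
  then have "card {d. d dvd a * b} \<le> card ({d. d dvd a} \<times> {d. d dvd b})"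
    using assms by (intro surj_card_le) auto
  then show ?thesis by (simp add: card_cartesian_product)
qed

lemma card_divisors_prod_le:
  fixes g :: "'a \<Rightarrow> nat"
  assumes "finite F" "\<And>p. p \<in> F \<Longrightarrow> g p > 0"
  shows "card {d. d dvd prod g F} \<le> (\<Prod>p\<in>F. card {d. d dvd g p})"
  using assms
proof (induction F rule: finite_induct)
  case (insert p F)
  then have "card {d. d dvd g p * prod g F} \<le> card {d. d dvd g p} * card {d. d dvd prod g F}"
    by (intro card_divisors_mult_le) (auto intro: prod_pos)
  also have "\<dots> \<le> card {d. d dvd g p} * (\<Prod>p\<in>F. card {d. d dvd g p})"
    using insert by (intro mult_left_mono) auto
  finally show ?case using insert by simp
qed simp

lemma card_divisors_prime_power_le:
  fixes p :: nat
  assumes "prime p"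
  shows "card {d. d dvd p ^ k} \<le> Suc k"
proof -
  have "{d. d dvd p ^ k} \<subseteq> (\<lambda>i. p ^ i) ` {..k}"
    using assms by (auto simp: divides_primepow_nat)
  then show ?thesis using surj_card_le[of "{..k}"] by simp
qed

text \<open>Each prime power contributes a factor k + 1, compared with p^(k \<epsilon>). Primes
  beyond exp (1 / \<epsilon>) cost nothing; each of the fewer than \<open>B\<close> smaller ones
  costs at most \<open>c\<close>, hence the constant \<open>c ^ B\<close>.\<close>

theorem divisor_bound:
  fixes \<epsilon> :: real
  assumes "\<epsilon> > 0"
  shows "\<exists>C\<ge>1. \<forall>n::nat. n > 0 \<longrightarrow> real (card {d. d dvd n}) \<le> C * real n powr \<epsilon>"
proof -
  define B where "B = nat \<lceil>exp (1 / \<epsilon>)\<rceil>"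
  define c where "c = 1 + 1 / (\<epsilon> * ln 2)"
  define w where "w p = (if p < B then c else 1)" for p :: nat
  have c: "c \<ge> 1" using assms by (simp add: c_def)
  have step: "real (Suc k) \<le> w p * real (p ^ k) powr \<epsilon>" if "prime p" for p k :: nat
  proof -
    have p: "p \<ge> 2" using that by (rule prime_ge_2_nat)
    have eq: "real (p ^ k) powr \<epsilon> = exp (\<epsilon> * ln p * k)"
      using p by (simp add: powr_def ln_realpow)
    show ?thesis
    proof (cases "p < B")
      case True
      \<comment> \<open>Expanding the right side gives 1 + k plus nonnegative terms; this is what
        dictates the choice of \<open>c\<close>.\<close>
      have "real (Suc k) \<le> c * (1 + \<epsilon> * ln 2 * k)"
        using assms by (simp add: c_def field_simps)
      also have "\<dots> \<le> c * exp (\<epsilon> * ln 2 * k)"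
        using c by (intro mult_left_mono exp_ge_add_one_self) auto
      also have "\<dots> \<le> c * exp (\<epsilon> * ln p * k)"
        using c p assms by (simp add: mult_right_mono)
      finally show ?thesis using True eq by (simp add: w_def)
    next
      case False
      then have "exp (1 / \<epsilon>) \<le> p" unfolding B_def by linarith
      then have "1 / \<epsilon> \<le> ln p" using p by (subst ln_ge_iff) auto
      then have "1 \<le> \<epsilon> * ln p" using assms by (simp add: field_simps)
      then have "1 * real k \<le> \<epsilon> * ln p * k" by (rule mult_right_mono) simp
      then have "real (Suc k) \<le> 1 + \<epsilon> * ln p * k" by simp
      also have "\<dots> \<le> exp (\<epsilon> * ln p * k)" by (rule exp_ge_add_one_self)
      finally show ?thesis using False eq by (simp add: w_def)
    qed
  qed
  have "real (card {d. d dvd n}) \<le> c ^ B * real n powr \<epsilon>" if "n > 0" for n :: nat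
  proof -
    let ?F = "prime_factors n" and ?g = "\<lambda>p. p ^ multiplicity p n"
    have n: "n = prod ?g ?F" using that by (rule prime_factorization_nat)
    have "real (card {d. d dvd n}) \<le> real (\<Prod>p\<in>?F. card {d. d dvd ?g p})"
      by (subst n, rule of_nat_mono, rule card_divisors_prod_le)
        (auto simp: prime_gt_0_nat in_prime_factors_imp_prime)
    also have "\<dots> = (\<Prod>p\<in>?F. real (card {d. d dvd ?g p}))" by simp
    also have "\<dots> \<le> (\<Prod>p\<in>?F. w p * real (?g p) powr \<epsilon>)"
    proof (intro prod_mono conjI)
      fix p assume "p \<in> ?F"
      then have p: "prime p" by (rule in_prime_factors_imp_prime)
      show "real (card {d. d dvd ?g p}) \<le> w p * real (?g p) powr \<epsilon>"
        using step[OF p] card_divisors_prime_power_le[OF p] of_nat_mono order_trans by blast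
    qed simp
    also have "\<dots> = (\<Prod>p\<in>?F. w p) * real n powr \<epsilon>"
      by (subst (3) n) (simp add: prod.distrib prod_powr_distrib)
    also have "(\<Prod>p\<in>?F. w p) \<le> c ^ B"
    proof -
      have "(\<Prod>p\<in>?F. w p) = c ^ card {p \<in> ?F. p < B}"
        by (simp add: w_def prod.If_cases Int_def)
      also have "\<dots> \<le> c ^ B"
        using c card_mono[of "{..<B}" "{p \<in> ?F. p < B}"] by (intro power_increasing) auto
      finally show ?thesis .
    qed
    finally show ?thesis by (simp add: mult_right_mono)
  qed
  moreover have "c ^ B \<ge> 1" using c by simp
  ultimately show ?thesis by blast
qed

subsection \<open>Counting close fractions with square denominators\<close>

text \<open>As b is invertible modulo n, the residue u fixes m modulo n. So m is determined by u,
  with at most 2T + 1 values, and by the quotient m div n, with at most 4.\<close>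

lemma card_linear_congruence_le:
  fixes n X :: nat and b :: int
  assumes "n > 0" "coprime b (int n)" "X \<le> 4 * n" "T \<ge> 0"
  shows "real (card {m. m < X \<and> (\<exists>u::int. \<bar>of_int u\<bar> \<le> T \<and> int n dvd b * int m - u)}) \<le> 4 * (2 * T + 1)"
    (is "real (card ?M) \<le> _")
proof -
  define v where "v m = (SOME u::int. \<bar>of_int u\<bar> \<le> T \<and> int n dvd b * int m - u)" for m :: nat
  have v: "\<bar>of_int (v m)\<bar> \<le> T" "int n dvd b * int m - v m" if "m \<in> ?M" for m
    using that someI_ex[of "\<lambda>u::int. \<bar>of_int u\<bar> \<le> T \<and> int n dvd b * int m - u"]
    by (auto simp: v_def)
  have "inj_on (\<lambda>m. (m div n, v m)) ?M"
  proof (rule inj_onI)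
    fix m m' assume M: "m \<in> ?M" "m' \<in> ?M" and "(m div n, v m) = (m' div n, v m')"
    then have eq: "m div n = m' div n" "v m = v m'" by auto
    have "int n dvd (b * int m - v m) - (b * int m' - v m')"
      by (rule dvd_diff[OF v(2)[OF M(1)] v(2)[OF M(2)]])
    then have "int n dvd b * (int m - int m')" using eq by (simp add: algebra_simps)
    then have "int n dvd int m - int m'"
      using assms by (simp add: coprime_dvd_mult_right_iff coprime_commute)
    then have "int m mod int n = int m' mod int n" by (simp add: mod_eq_dvd_iff)
    then have "m mod n = m' mod n" by (simp flip: zmod_int)
    with eq show "m = m'" by (metis div_mult_mod_eq)
  qed
  moreover have "(\<lambda>m. (m div n, v m)) ` ?M \<subseteq> {..<4} \<times> {-\<lfloor>T\<rfloor>..\<lfloor>T\<rfloor>}"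
  proof (intro image_subsetI)
    fix m assume m: "m \<in> ?M"
    have "m div n < 4"
      using m assms by (intro less_mult_imp_div_less) auto
    moreover have "-\<lfloor>T\<rfloor> \<le> v m \<and> v m \<le> \<lfloor>T\<rfloor>"
      using v(1)[OF m] by linarith
    ultimately show "(m div n, v m) \<in> {..<4} \<times> {-\<lfloor>T\<rfloor>..\<lfloor>T\<rfloor>}" by simp
  qed
  ultimately have "card ?M \<le> card ({..<4::nat} \<times> {-\<lfloor>T\<rfloor>..\<lfloor>T\<rfloor>})"
    by (rule card_inj_on_le) simp
  then have "real (card ?M) \<le> 4 * real (nat (2 * \<lfloor>T\<rfloor> + 1))"
    by (simp add: card_cartesian_product)
  also have "\<dots> \<le> 4 * (2 * T + 1)" using \<open>T \<ge> 0\<close> by simp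
  finally show ?thesis .
qed

text \<open>
  A pair y < x in A is determined by the difference m of its squares and the divisor x - y of m.
\<close>

lemma card_sq_le_divisor_sum:
  fixes A :: "nat set"
  assumes "finite A" "finite M" "0 \<notin> M"
    and diff: "\<And>x y. x \<in> A \<Longrightarrow> y \<in> A \<Longrightarrow> y < x \<Longrightarrow> x ^ 2 - y ^ 2 \<in> M"
  shows "card A ^ 2 \<le> card A + 2 * (\<Sum>m\<in>M. card {d. d dvd m})"
proof -
  let ?U = "{p \<in> A \<times> A. snd p < fst p}" and ?L = "{p \<in> A \<times> A. fst p < snd p}"
  let ?S = "SIGMA m:M. {d. d dvd m}"
  have fact: "x ^ 2 - y ^ 2 = (x - y) * (x + y)" for x y :: nat
  proof (cases "y \<le> x")
    case True
    then obtain z where "x = y + z" using le_Suc_ex by blast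
    then show ?thesis by (simp add: power2_eq_square algebra_simps)
  qed simp
  have fin: "finite ?S"
    using assms by (intro finite_SigmaI) (auto intro!: finite_divisors_nat Nat.gr0I)
  have "card ?U \<le> card ?S"
  proof (rule card_inj_on_le[where f = "\<lambda>(x, y). (x ^ 2 - y ^ 2, x - y)"])
    show "inj_on (\<lambda>(x, y). (x ^ 2 - y ^ 2, x - y)) ?U"
    proof (rule inj_onI, clarsimp)
      fix x y x' y' :: nat
      assume lt: "y < x" "y' < x'" and eq: "x\<^sup>2 - y\<^sup>2 = x'\<^sup>2 - y'\<^sup>2" "x - y = x' - y'"
      then have "(x - y) * (x + y) = (x - y) * (x' + y')" by (simp add: fact)
      then have "x + y = x' + y'" using lt by simp
      then show "x = x' \<and> y = y'" using eq(2) lt by linarith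
    qed
  qed (use fin diff fact in auto)
  moreover have "card ?L = card ?U"
    by (rule bij_betw_same_card[of prod.swap]) (auto simp: bij_betw_def image_iff)
  \<comment> \<open>Ordered pairs split into the diagonal and two halves exchanged by
    \<open>prod.swap\<close>.\<close>
  moreover have "card (A \<times> A) \<le> card ((\<lambda>x. (x, x)) ` A) + card ?U + card ?L"
  proof -
    have "A \<times> A = (\<lambda>x. (x, x)) ` A \<union> ?U \<union> ?L" by (auto simp: image_iff)
    then have "card (A \<times> A) = card ((\<lambda>x. (x, x)) ` A \<union> ?U \<union> ?L)" by simp
    also have "\<dots> \<le> card ((\<lambda>x. (x, x)) ` A) + card ?U + card ?L"
      using card_Un_le[of "(\<lambda>x. (x, x)) ` A \<union> ?U" ?L] card_Un_le[of "(\<lambda>x. (x, x)) ` A" ?U] by linarith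
    finally show ?thesis .
  qed
  moreover have "card ((\<lambda>x. (x, x)) ` A) = card A" by (intro card_image) (auto simp: inj_on_def)
  moreover have "card ?S = (\<Sum>m\<in>M. card {d. d dvd m})"
    using assms by (intro card_SigmaI) (auto intro!: finite_divisors_nat Nat.gr0I)
  ultimately show ?thesis by (simp add: card_cartesian_product power2_eq_square)
qed

text \<open>Extracts a cardinality from the count of its pairs: for c \<ge> 1, (c - 1)^2 \<le> y + 1
  - c \<le> y.\<close>

lemma le_one_plus_sqrt:
  fixes c y :: real
  assumes "c ^ 2 \<le> c + y" "y \<ge> 0"
  shows "c \<le> 1 + sqrt y"
proof (cases "c \<ge> 1")
  case True
  with assms have "(c - 1) ^ 2 \<le> y" by (simp add: power2_diff)
  then have "c - 1 \<le> sqrt y" by (rule real_le_rsqrt)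
  then show ?thesis by simp
next
  case False
  then show ?thesis using real_sqrt_ge_zero[OF assms(2)] by linarith
qed

text \<open>Subtracting the congruences of two members linearizes the problem in the difference of
  their squares, which is then counted by \<open>card_linear_congruence_le\<close> and factored by
  \<open>card_sq_le_divisor_sum\<close>.\<close>

lemma card_square_congruence_le:
  fixes P r :: nat and b :: int
  assumes "P > 0" "P \<le> r" "coprime b (int r)" "T \<ge> 0" "D \<ge> 0"
    and D: "\<And>m. 0 < m \<Longrightarrow> m < 4 * P ^ 2 \<Longrightarrow> real (card {d. d dvd m}) \<le> D"
  shows "real (card {q \<in> {P..<2 * P}. \<exists>u::int. \<bar>of_int u\<bar> \<le> T \<and> int (r ^ 2) dvd b * int (q ^ 2) - u})
    \<le> 1 + sqrt (8 * D * (4 * T + 1))" (is "real (card ?A) \<le> _")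
proof -
  \<comment> \<open>Two residues of size T differ by at most 2T, and P \<le> r puts all differences
    below 4 r^2, as the factor 4 in \<open>card_linear_congruence_le\<close> requires.\<close>
  define M where "M = {m. 0 < m \<and> m < 4 * P ^ 2 \<and>
    (\<exists>u::int. \<bar>of_int u\<bar> \<le> 2 * T \<and> int (r ^ 2) dvd b * int m - u)}"
  have M: "real (card M) \<le> 4 * (2 * (2 * T) + 1)"
  proof -
    have "card M \<le> card {m. m < 4 * P ^ 2 \<and>
        (\<exists>u::int. \<bar>of_int u\<bar> \<le> 2 * T \<and> int (r ^ 2) dvd b * int m - u)}"
      unfolding M_def by (intro card_mono) auto
    also have "real \<dots> \<le> 4 * (2 * (2 * T) + 1)"
      using assms by (intro card_linear_congruence_le) (auto intro: power_mono)
    finally show ?thesis by simp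
  qed
  have "card ?A ^ 2 \<le> card ?A + 2 * (\<Sum>m\<in>M. card {d. d dvd m})"
  proof (rule card_sq_le_divisor_sum)
    fix x y assume xy: "x \<in> ?A" "y \<in> ?A" "y < x"
    then obtain u v :: int where u: "\<bar>of_int u\<bar> \<le> T" "int (r ^ 2) dvd b * int (x ^ 2) - u"
      and v: "\<bar>of_int v\<bar> \<le> T" "int (r ^ 2) dvd b * int (y ^ 2) - v" by blast
    have lt: "y ^ 2 < x ^ 2" using xy by (intro power_strict_mono) auto
    have "x ^ 2 < (2 * P) ^ 2" using xy by (intro power_strict_mono) auto
    then have "x ^ 2 - y ^ 2 < 4 * P ^ 2" by (simp add: power_mult_distrib)
    moreover have "int (r ^ 2) dvd (b * int (x ^ 2) - u) - (b * int (y ^ 2) - v)"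
      by (rule dvd_diff[OF u(2) v(2)])
    then have "int (r ^ 2) dvd b * int (x ^ 2 - y ^ 2) - (u - v)"
      using lt by (simp add: right_diff_distrib of_nat_diff less_imp_le diff_diff_eq2 algebra_simps del: of_nat_power)
    moreover have "\<bar>of_int (u - v)\<bar> \<le> 2 * T" using u(1) v(1) by simp
    ultimately show "x ^ 2 - y ^ 2 \<in> M"
      unfolding M_def using lt by (intro CollectI conjI exI[of _ "u - v"]) auto
  qed (auto simp: M_def)
  then have "real (card ?A ^ 2) \<le> real (card ?A + 2 * (\<Sum>m\<in>M. card {d. d dvd m}))"
    by (rule of_nat_mono)
  then have sq: "real (card ?A) ^ 2 \<le> real (card ?A) + 2 * (\<Sum>m\<in>M. real (card {d. d dvd m}))"
    by (simp only: of_nat_power of_nat_add of_nat_mult of_nat_sum of_nat_numeral)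
  have "(\<Sum>m\<in>M. real (card {d. d dvd m})) \<le> (\<Sum>m\<in>M. D)"
    by (intro sum_mono D) (auto simp: M_def)
  also have "\<dots> = D * card M" by simp
  also have "\<dots> \<le> D * (4 * (4 * T + 1))" using M \<open>D \<ge> 0\<close> by (intro mult_left_mono) auto
  also have "\<dots> = 8 * D * (4 * T + 1) / 2" by simp
  finally have "real (card ?A) ^ 2 \<le> real (card ?A) + 8 * D * (4 * T + 1)" using sq by linarith
  then show ?thesis using \<open>T \<ge> 0\<close> \<open>D \<ge> 0\<close> by (intro le_one_plus_sqrt) auto
qed

text \<open>The hypothesis keeps the bound nonnegative, so that it covers empty intervals
  too.\<close>

lemma card_int_interval_le:
  fixes x y :: real
  assumes "x \<le> y + 1"
  shows "finite {n::int. x \<le> of_int n \<and> of_int n \<le> y}"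
    and "real (card {n::int. x \<le> of_int n \<and> of_int n \<le> y}) \<le> y - x + 1"
proof -
  have eq: "{n::int. x \<le> of_int n \<and> of_int n \<le> y} = {\<lceil>x\<rceil>..\<lfloor>y\<rfloor>}"
    by (auto simp: le_floor_iff ceiling_le_iff)
  show "finite {n::int. x \<le> of_int n \<and> of_int n \<le> y}" unfolding eq by simp
  have "real (nat (\<lfloor>y\<rfloor> + 1 - \<lceil>x\<rceil>)) \<le> y - x + 1"
    using assms by linarith
  then show "real (card {n::int. x \<le> of_int n \<and> of_int n \<le> y}) \<le> y - x + 1"
    unfolding eq by simp
qed

text \<open>If k is the integer witnessing closeness, a + k n is an integer within n \<delta> of n
  x, and a is recovered from it as the residue modulo n.\<close>

lemma card_close_numerators_le:
  fixes n :: nat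
  assumes "n > 0" "\<delta> \<ge> 0"
  shows "real (card {a. a < n \<and> near_int \<delta> (x - real a / real n)}) \<le> 2 * real n * \<delta> + 1"
    (is "real (card ?A) \<le> _")
proof -
  define k where "k a = (SOME k::int. \<bar>x - real a / real n - of_int k\<bar> \<le> \<delta>)" for a
  have k: "\<bar>x - real a / real n - of_int (k a)\<bar> \<le> \<delta>" if "a \<in> ?A" for a
    unfolding k_def by (rule someI_ex) (use that in \<open>auto simp: near_int_def\<close>)
  let ?I = "{m::int. n * (x - \<delta>) \<le> of_int m \<and> of_int m \<le> n * (x + \<delta>)}"
  have le: "n * (x - \<delta>) \<le> n * (x + \<delta>) + 1"
    using assms by (simp add: algebra_simps add_increasing)
  have "inj_on (\<lambda>a. int a + k a * int n) ?A"
  proof (rule inj_onI)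
    fix a a' assume A: "a \<in> ?A" "a' \<in> ?A" and eq: "int a + k a * int n = int a' + k a' * int n"
    have "int a = (int a + k a * int n) mod int n" using A by simp
    also have "\<dots> = int a'" using A eq by simp
    finally show "a = a'" by simp
  qed
  moreover have "(\<lambda>a. int a + k a * int n) ` ?A \<subseteq> ?I"
  proof (intro image_subsetI)
    fix a assume "a \<in> ?A"
    then have "\<bar>x - real a / real n - of_int (k a)\<bar> \<le> \<delta>" by (rule k)
    then have "x - \<delta> \<le> real a / real n + of_int (k a)" "real a / real n + of_int (k a) \<le> x + \<delta>"
      by linarith+
    then have "n * (x - \<delta>) \<le> n * (real a / real n + of_int (k a))"
      "n * (real a / real n + of_int (k a)) \<le> n * (x + \<delta>)"
      by (auto intro: mult_left_mono)
    moreover have "n * (real a / real n + of_int (k a)) = of_int (int a + k a * int n)"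
      using assms by (simp add: field_simps)
    ultimately show "int a + k a * int n \<in> ?I" by simp
  qed
  ultimately have "card ?A \<le> card ?I"
    by (rule card_inj_on_le) (rule card_int_interval_le[OF le])
  also have "real (card ?I) \<le> n * (x + \<delta>) - n * (x - \<delta>) + 1"
    by (rule card_int_interval_le[OF le])
  finally show ?thesis by (simp add: algebra_simps)
qed

text \<open>The divisor bound is assumed only for 8 P^2 \<Delta> < 1, the case in which pairs are
  counted; in the application this condition keeps m below N.\<close>

lemma card_close_fractions_le:
  fixes P r b :: nat
  assumes P: "P > 0" "r \<in> {P..<2 * P}" and b: "coprime b r" and "\<Delta> > 0" "D \<ge> 1"
    and D: "\<And>m. 0 < m \<Longrightarrow> m < 4 * P ^ 2 \<Longrightarrow> 8 * real P ^ 2 * \<Delta> < 1 \<Longrightarrow> real (card {d. d dvd m}) \<le> D"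
  shows "real (card {(q, a). q \<in> {P..<2 * P} \<and> a < q ^ 2 \<and> near_int \<Delta> (real b / real (r ^ 2) - real a / real (q ^ 2))})
    \<le> 16 * real P ^ 3 * \<Delta> + 8 * D * (1 + 8 * real P ^ 2 * sqrt \<Delta>)"
    (is "real (card ?S) \<le> _")
proof -
  let ?B = "{P..<2 * P}"
  let ?F = "\<lambda>q. {a. a < q ^ 2 \<and> near_int \<Delta> (real b / real (r ^ 2) - real a / real (q ^ 2))}"
  define A where "A = {q \<in> ?B. \<exists>u::int. \<bar>of_int u\<bar> \<le> 16 * real P ^ 4 * \<Delta> \<and>
    int (r ^ 2) dvd int b * int (q ^ 2) - u}"
  have sq: "real q ^ 2 \<le> 4 * real P ^ 2" if "q \<in> ?B" for q
  proof -
    have "real q ^ 2 \<le> (2 * real P) ^ 2" using that by (intro power_mono) auto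
    then show ?thesis by (simp add: power_mult_distrib)
  qed
  have in_A: "q \<in> A" if q: "q \<in> ?B" and a: "a \<in> ?F q" for q a
  proof -
    from a obtain k :: int where k: "\<bar>real b / real (r ^ 2) - real a / real (q ^ 2) - of_int k\<bar> \<le> \<Delta>"
      by (auto simp: near_int_def)
    \<comment> \<open>Clearing denominators: u is q^2 r^2 times the signed distance modulo 1, and
      both squares are at most 4 P^2.\<close>
    define u where "u = int b * int (q ^ 2) - (int a + k * int (q ^ 2)) * int (r ^ 2)"
    have pos: "real q > 0" "real r > 0" using q P by auto
    have "of_int u = (real b / real (r ^ 2) - real a / real (q ^ 2) - of_int k) * (real q ^ 2 * real r ^ 2)"
      using pos by (simp add: u_def field_simps)
    then have "\<bar>of_int u\<bar> = \<bar>real b / real (r ^ 2) - real a / real (q ^ 2) - of_int k\<bar> * (real q ^ 2 * real r ^ 2)"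
      by (simp add: abs_mult)
    also have "\<dots> \<le> \<Delta> * ((4 * real P ^ 2) * (4 * real P ^ 2))"
      using k sq[OF q] sq[OF P(2)] \<open>\<Delta> > 0\<close> by (intro mult_mono) auto
    also have "\<dots> = 16 * real P ^ 4 * \<Delta>" by (simp add: eval_nat_numeral)
    finally have "\<bar>of_int u\<bar> \<le> 16 * real P ^ 4 * \<Delta>" .
    moreover have "int (r ^ 2) dvd int b * int (q ^ 2) - u" by (simp add: u_def)
    ultimately show ?thesis unfolding A_def using q by blast
  qed
  have finA: "finite A" by (simp add: A_def)
  have fiber: "real (card (?F q)) \<le> 8 * real P ^ 2 * \<Delta> + 1" if "q \<in> A" for q
  proof -
    have q: "q \<in> ?B" using that by (simp add: A_def)
    have "real (card (?F q)) \<le> 2 * real (q ^ 2) * \<Delta> + 1"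
      using q P \<open>\<Delta> > 0\<close> by (intro card_close_numerators_le) auto
    also have "\<dots> \<le> 2 * (4 * real P ^ 2) * \<Delta> + 1"
      using sq[OF q] \<open>\<Delta> > 0\<close> by (intro add_mono mult_right_mono mult_left_mono) auto
    finally show ?thesis by simp
  qed
  have "card ?S \<le> card (SIGMA q:A. ?F q)"
    using finA in_A by (intro card_mono) auto
  also have "\<dots> = (\<Sum>q\<in>A. card (?F q))"
    using finA by (intro card_SigmaI) auto
  also have "real \<dots> \<le> (\<Sum>q\<in>A. 8 * real P ^ 2 * \<Delta> + 1)"
    using fiber by (simp add: sum_mono del: sum_constant)
  finally have S: "real (card ?S) \<le> card A * (8 * real P ^ 2 * \<Delta> + 1)" by simp
  show ?thesis
  proof (cases "8 * real P ^ 2 * \<Delta> < 1")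
    case False
    have "A \<subseteq> ?B" by (auto simp: A_def)
    then have "card A \<le> P" using card_mono[of ?B A] by simp
    \<comment> \<open>In this range the 1 is absorbed, and all P denominators can be
      afforded.\<close>
    moreover have "8 * real P ^ 2 * \<Delta> + 1 \<le> 16 * real P ^ 2 * \<Delta>" using False by linarith
    ultimately have "card A * (8 * real P ^ 2 * \<Delta> + 1) \<le> P * (16 * real P ^ 2 * \<Delta>)"
      using \<open>\<Delta> > 0\<close> by (intro mult_mono) auto
    also have "\<dots> = 16 * real P ^ 3 * \<Delta>" by (simp add: eval_nat_numeral)
    also have "\<dots> \<le> 16 * real P ^ 3 * \<Delta> + 8 * D * (1 + 8 * real P ^ 2 * sqrt \<Delta>)"
      using \<open>D \<ge> 1\<close> \<open>\<Delta> > 0\<close> by simp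
    finally show ?thesis using S by simp
  next
    case True
    have "real (card A) \<le> 1 + sqrt (8 * D * (4 * (16 * real P ^ 4 * \<Delta>) + 1))"
      unfolding A_def using assms True by (intro card_square_congruence_le) auto
    also have "sqrt (8 * D * (4 * (16 * real P ^ 4 * \<Delta>) + 1)) \<le> 3 * D * (1 + 8 * real P ^ 2 * sqrt \<Delta>)"
    proof (rule real_le_lsqrt)
      \<comment> \<open>Here D \<ge> 1 gives 8 D \<le> 9 D^2, chosen as a perfect square; the
        bracket is completed to a square next.\<close>
      have "8 * D * (4 * (16 * real P ^ 4 * \<Delta>) + 1) \<le> 9 * D ^ 2 * (1 + 64 * real P ^ 4 * \<Delta>)"
        using \<open>D \<ge> 1\<close> \<open>\<Delta> > 0\<close> self_le_power[of D 2] by (intro mult_mono) auto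
      also have "\<dots> \<le> 9 * D ^ 2 * (1 + 8 * real P ^ 2 * sqrt \<Delta>) ^ 2"
      proof (intro mult_left_mono)
        have "(1 + 8 * real P ^ 2 * sqrt \<Delta>) ^ 2 = 1 + 64 * real P ^ 4 * \<Delta> + 16 * real P ^ 2 * sqrt \<Delta>"
          using \<open>\<Delta> > 0\<close> by (simp add: power2_sum power_mult_distrib flip: power_mult)
        then show "1 + 64 * real P ^ 4 * \<Delta> \<le> (1 + 8 * real P ^ 2 * sqrt \<Delta>) ^ 2"
          using \<open>\<Delta> > 0\<close> by simp
      qed simp
      also have "\<dots> = (3 * D * (1 + 8 * real P ^ 2 * sqrt \<Delta>)) ^ 2"
        by (simp add: power_mult_distrib)
      finally show "8 * D * (4 * (16 * real P ^ 4 * \<Delta>) + 1) \<le> (3 * D * (1 + 8 * real P ^ 2 * sqrt \<Delta>)) ^ 2" .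
    qed (use \<open>D \<ge> 1\<close> \<open>\<Delta> > 0\<close> in auto)
    also have "1 + 3 * D * (1 + 8 * real P ^ 2 * sqrt \<Delta>) \<le> 4 * D * (1 + 8 * real P ^ 2 * sqrt \<Delta>)"
    proof -
      have "1 * 1 \<le> D * (1 + 8 * real P ^ 2 * sqrt \<Delta>)"
        using \<open>D \<ge> 1\<close> \<open>\<Delta> > 0\<close> by (intro mult_mono) auto
      then show ?thesis by simp
    qed
    finally have "real (card A) \<le> 4 * D * (1 + 8 * real P ^ 2 * sqrt \<Delta>)" by simp
    \<comment> \<open>The number of numerators per denominator is bounded by 8 P^2 \<Delta> + 1 < 2,
      whence the factor 2.\<close>
    then have "card A * (8 * real P ^ 2 * \<Delta> + 1) \<le> 4 * D * (1 + 8 * real P ^ 2 * sqrt \<Delta>) * 2"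
      using True \<open>D \<ge> 1\<close> \<open>\<Delta> > 0\<close> by (intro mult_mono) auto
    moreover have "0 \<le> 16 * real P ^ 3 * \<Delta>" using \<open>\<Delta> > 0\<close> by simp
    ultimately show ?thesis using S by linarith
  qed
qed

section \<open>Dyadic blocks of moduli and their summation\<close>

lemma finite_coprime_residues_sq [simp]: "finite (coprime_residues_sq q)"
  by (simp add: coprime_residues_sq_def)

lemma large_sieve_square_block:
  fixes P N :: nat and \<epsilon> C :: real
  assumes "P > 0" "N > 0" "\<epsilon> > 0" "C \<ge> 1"
    and C: "\<And>m::nat. m > 0 \<Longrightarrow> real (card {d. d dvd m}) \<le> C * real m powr \<epsilon>"
  shows "(\<Sum>q\<in>{P..<2 * P}. \<Sum>r\<in>coprime_residues_sq q.
      cmod (\<Sum>n = M + 1..M + int N. a n * e (of_nat r / of_nat (q ^ 2) * of_int n)) ^ 2)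
    \<le> 512 * C * (real P ^ 3 + (N + sqrt N * real P ^ 2) * N powr \<epsilon>)
        * (\<Sum>n = M + 1..M + int N. cmod (a n) ^ 2)"
proof -
  define R where "R = (SIGMA q:{P..<2 * P}. coprime_residues_sq q)"
  define \<alpha> where "\<alpha> = (\<lambda>(q, r). real r / real q ^ 2)"
  define D where "D = C * N powr \<epsilon>"
  \<comment> \<open>This is the bound of \<open>card_close_fractions_le\<close> at the radius 1 /
    N.\<close>
  define K where "K = 16 * real P ^ 3 / N + 8 * D * (1 + 8 * real P ^ 2 / sqrt N)"
  have D: "D \<ge> 1"
  proof -
    have "1 * 1 \<le> C * N powr \<epsilon>"
      using assms ge_one_powr_ge_zero[of "real N" \<epsilon>] by (intro mult_mono) auto
    then show ?thesis by (simp add: D_def)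
  qed
  have card: "real (card {s \<in> R. near_int (2 ^ i / real N) (\<alpha> x - \<alpha> s)}) \<le> 2 ^ i * K"
    if x: "x \<in> R" for x i
  proof -
    obtain r b where [simp]: "x = (r, b)" by (cases x)
    have r: "r \<in> {P..<2 * P}" and b: "coprime b r"
      using x by (auto simp: R_def coprime_residues_sq_def)
    let ?\<Delta> = "2 ^ i / real N"
    let ?S = "{(q, a). q \<in> {P..<2 * P} \<and> a < q ^ 2 \<and> near_int ?\<Delta> (real b / real (r ^ 2) - real a / real (q ^ 2))}"
    have fin: "finite ?S"
      by (rule finite_subset[of _ "SIGMA q:{P..<2 * P}. {..<q ^ 2}"]) auto
    have pow: "(1::real) \<le> 2 ^ i" by simp
    have "card {s \<in> R. near_int ?\<Delta> (\<alpha> x - \<alpha> s)} \<le> card ?S"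
      by (rule card_mono[OF fin]) (auto simp: R_def \<alpha>_def coprime_residues_sq_def)
    also have "real \<dots> \<le> 16 * real P ^ 3 * ?\<Delta> + 8 * D * (1 + 8 * real P ^ 2 * sqrt ?\<Delta>)"
    proof (rule card_close_fractions_le[OF \<open>P > 0\<close> r b _ D])
      fix m :: nat assume m: "0 < m" "m < 4 * P ^ 2" "8 * real P ^ 2 * ?\<Delta> < 1"
      \<comment> \<open>Since 2^i \<ge> 1, the case assumption forces 8 P^2 < N, so m < N and its
        divisors number at most C N^\<epsilon>. This is why the loss is a power of N and not of
        P.\<close>
      have "8 * real P ^ 2 * 1 \<le> 8 * real P ^ 2 * 2 ^ i" by (intro mult_left_mono pow) simp
      also have "\<dots> < N" using m(3) \<open>N > 0\<close> by (simp add: field_simps)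
      finally have "real (8 * P ^ 2) < real N" by simp
      then have "8 * P ^ 2 < N" by (simp only: of_nat_less_iff)
      then have "m \<le> N" using m(2) by simp
      then have "C * real m powr \<epsilon> \<le> D"
        unfolding D_def using assms by (intro mult_left_mono powr_mono2) auto
      with C[OF m(1)] show "real (card {d. d dvd m}) \<le> D" by simp
    qed (use \<open>N > 0\<close> in auto)
    also have "\<dots> \<le> 2 ^ i * (16 * real P ^ 3 / N) + 2 ^ i * (8 * D * (1 + 8 * real P ^ 2 / sqrt N))"
    proof (rule add_mono)
      \<comment> \<open>The square-root term grows only like 2^(i/2), so the linear growth demanded
        by \<open>large_sieve\<close> holds with room to spare.\<close>
      have "sqrt (2 ^ i) \<le> 2 ^ i" using pow by (intro real_le_lsqrt) (auto simp: self_le_power)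
      then have s: "sqrt ?\<Delta> \<le> 2 ^ i / sqrt N"
        unfolding real_sqrt_divide by (intro divide_right_mono) auto
      have "1 + 8 * real P ^ 2 * sqrt ?\<Delta> \<le> 2 ^ i + 8 * real P ^ 2 * (2 ^ i / sqrt N)"
        using s pow by (intro add_mono mult_left_mono) auto
      also have "\<dots> = 2 ^ i * (1 + 8 * real P ^ 2 / sqrt N)" by (simp add: algebra_simps)
      finally have "8 * D * (1 + 8 * real P ^ 2 * sqrt ?\<Delta>) \<le> 8 * D * (2 ^ i * (1 + 8 * real P ^ 2 / sqrt N))"
        using D by (intro mult_left_mono) auto
      then show "8 * D * (1 + 8 * real P ^ 2 * sqrt ?\<Delta>) \<le> 2 ^ i * (8 * D * (1 + 8 * real P ^ 2 / sqrt N))"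
        by (simp only: mult_ac)
    qed (simp add: mult.commute)
    finally show ?thesis by (simp add: K_def ring_distribs)
  qed
  have "K \<ge> 0" using D by (simp add: K_def)
  have finR: "finite R" by (simp add: R_def)
  \<comment> \<open>The coefficients are 8 * 16 = 128, 8 * 8 = 64 and 64 * 8 = 512; the largest
    serves for all terms.\<close>
  have "8 * real N * K = 128 * real P ^ 3 + 64 * C * (N + 8 * (real N / sqrt N) * real P ^ 2) * N powr \<epsilon>"
    using \<open>N > 0\<close> by (simp add: K_def D_def field_simps)
  also have "real N / sqrt N = sqrt N" by (simp add: real_div_sqrt)
  also have "128 * real P ^ 3 + 64 * C * (N + 8 * sqrt N * real P ^ 2) * N powr \<epsilon>
      \<le> 512 * C * real P ^ 3 + 512 * C * (N + sqrt N * real P ^ 2) * N powr \<epsilon>"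
  proof (rule add_mono)
    show "128 * real P ^ 3 \<le> 512 * C * real P ^ 3"
      using \<open>C \<ge> 1\<close> by (intro mult_right_mono) auto
    have "64 * (N + 8 * sqrt N * real P ^ 2) \<le> 512 * (N + sqrt N * real P ^ 2)" by simp
    then have "C * (64 * (N + 8 * sqrt N * real P ^ 2)) * N powr \<epsilon> \<le> C * (512 * (N + sqrt N * real P ^ 2)) * N powr \<epsilon>"
      using \<open>C \<ge> 1\<close> by (intro mult_right_mono mult_left_mono) auto
    then show "64 * C * (N + 8 * sqrt N * real P ^ 2) * N powr \<epsilon> \<le> 512 * C * (N + sqrt N * real P ^ 2) * N powr \<epsilon>"
      by (simp only: mult_ac)
  qed
  finally have K: "8 * real N * K \<le> 512 * C * (real P ^ 3 + (N + sqrt N * real P ^ 2) * N powr \<epsilon>)"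
    by (simp only: ring_distribs mult.assoc)
  have "(\<Sum>q\<in>{P..<2 * P}. \<Sum>r\<in>coprime_residues_sq q.
      cmod (\<Sum>n = M + 1..M + int N. a n * e (of_nat r / of_nat (q ^ 2) * of_int n)) ^ 2)
     = (\<Sum>x\<in>R. cmod (\<Sum>n = M + 1..M + int N. a n * e (of_real (\<alpha> x) * of_int n)) ^ 2)"
    unfolding R_def by (subst sum.Sigma) (auto simp: \<alpha>_def intro!: sum.cong)
  also have "\<dots> \<le> 8 * real N * K * (\<Sum>n = M + 1..M + int N. cmod (a n) ^ 2)"
    by (rule large_sieve[OF finR \<open>N > 0\<close> card \<open>K \<ge> 0\<close>])
  also have "\<dots> \<le> 512 * C * (real P ^ 3 + (N + sqrt N * real P ^ 2) * N powr \<epsilon>)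
        * (\<Sum>n = M + 1..M + int N. cmod (a n) ^ 2)"
    by (intro mult_right_mono K sum_nonneg) auto
  finally show ?thesis .
qed

lemma sum_dyadic_blocks:
  fixes h :: "nat \<Rightarrow> 'a :: comm_monoid_add"
  shows "sum h {1..<2 ^ k} = (\<Sum>i<k. sum h {2 ^ i..<2 * 2 ^ i})"
proof (induction k)
  case (Suc k)
  have "sum h {1..<2 ^ Suc k} = sum h {1..<2 ^ k} + sum h {2 ^ k..<2 ^ Suc k}"
    by (subst sum.atLeastLessThan_concat) auto
  then show ?case using Suc by simp
qed simp

theorem theorem2:
  shows "\<forall>\<epsilon>::real. \<epsilon> > 0 \<longrightarrow>
    (\<exists>C::real. C > 0 \<and>
      (\<forall>(a :: int \<Rightarrow> complex) (Q :: nat) (M :: int) (N :: int). Q > 0 \<longrightarrow> N > 0 \<longrightarrow>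
        (\<Sum>q = 1..Q. \<Sum>r\<in>coprime_residues_sq q.
            (cmod (\<Sum>n = M + 1..M + N. a n * e (of_nat r / of_nat (q ^ 2) * of_int n))) ^ 2)
        \<le> C * ln (2 * real Q)
            * (real Q ^ 3
               + (real_of_int N * sqrt (real Q) + sqrt (real_of_int N) * real Q ^ 2)
                 * real_of_int N powr \<epsilon>)
            * (\<Sum>n = M + 1..M + N. (cmod (a n)) ^ 2)))"
proof (intro allI impI)
  fix \<epsilon> :: real assume \<epsilon>: "\<epsilon> > 0"
  obtain C where C: "C \<ge> 1" "\<And>m::nat. m > 0 \<Longrightarrow> real (card {d. d dvd m}) \<le> C * real m powr \<epsilon>"
    using divisor_bound[OF \<epsilon>] by blast
  have bound: "(\<Sum>q = 1..Q. \<Sum>r\<in>coprime_residues_sq q.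
            (cmod (\<Sum>n = M + 1..M + N. a n * e (of_nat r / of_nat (q ^ 2) * of_int n))) ^ 2)
        \<le> 512 * C / ln 2 * ln (2 * real Q)
            * (real Q ^ 3
               + (real_of_int N * sqrt (real Q) + sqrt (real_of_int N) * real Q ^ 2)
                 * real_of_int N powr \<epsilon>)
            * (\<Sum>n = M + 1..M + N. (cmod (a n)) ^ 2)" (is "sum ?h _ \<le> _ * _ * ?X * ?Z")
    if "Q > 0" "N > 0" for a Q M N
  proof -
    obtain N' :: nat where N: "N = int N'" "N' > 0" using \<open>N > 0\<close> zero_less_imp_eq_int by auto
    \<comment> \<open>The k + 1 blocks [2^i, 2^(i+1)) with i \<le> k cover 1..Q, and each starts at
      or below Q.\<close>
    obtain k where k: "2 ^ k \<le> Q" "Q < 2 ^ (k + 1)"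
      using ex_power_ivl1[of 2 Q] \<open>Q > 0\<close> by auto
    have nonneg: "?h q \<ge> 0" for q by (intro sum_nonneg) auto
    have XZ: "?X \<ge> 0" "?Z \<ge> 0" using \<open>N > 0\<close> by (auto intro: sum_nonneg)
    have block: "sum ?h {2 ^ i..<2 * 2 ^ i} \<le> 512 * C * ?X * ?Z" if "i < Suc k" for i
    proof -
      let ?P = "2 ^ i :: nat"
      have "(2::nat) ^ i \<le> 2 ^ k" using that by (intro power_increasing) auto
      with k have P: "?P \<le> Q" by linarith
      have "sum ?h {?P..<2 * ?P} \<le> 512 * C * (real ?P ^ 3 + (N' + sqrt N' * real ?P ^ 2) * N' powr \<epsilon>) * ?Z"
        unfolding N using large_sieve_square_block[OF _ N(2) \<epsilon> C, where P = ?P and M = M and a = a] by simp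
      also have "\<dots> \<le> 512 * C * (real Q ^ 3 + (N' * sqrt Q + sqrt N' * real Q ^ 2) * N' powr \<epsilon>) * ?Z"
      proof (intro mult_right_mono mult_left_mono add_mono)
        show "real ?P ^ 3 \<le> real Q ^ 3" "real ?P ^ 2 \<le> real Q ^ 2"
          using P by (intro power_mono of_nat_mono; simp)+
        \<comment> \<open>A block gives N without the factor sqrt Q, which is inserted here to match
          the stated bound.\<close>
        have "real N' * 1 \<le> real N' * sqrt Q" using \<open>Q > 0\<close> by (intro mult_left_mono) auto
        then show "real N' \<le> real N' * sqrt Q" by simp
      qed (use C XZ in auto)
      finally show ?thesis by (simp add: N)
    qed
    \<comment> \<open>The last block may run past Q; its extra terms are nonnegative.\<close>
    have "sum ?h {1..Q} \<le> sum ?h {1..<2 ^ Suc k}"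
      using k nonneg by (intro sum_mono2) auto
    also have "\<dots> = (\<Sum>i<Suc k. sum ?h {2 ^ i..<2 * 2 ^ i})" by (rule sum_dyadic_blocks)
    also have "\<dots> \<le> (\<Sum>i<Suc k. 512 * C * ?X * ?Z)"
      by (intro sum_mono block) simp
    also have "\<dots> = real (Suc k) * (512 * C * ?X * ?Z)" by simp
    also have "\<dots> \<le> ln (2 * real Q) / ln 2 * (512 * C * ?X * ?Z)"
    proof (intro mult_right_mono)
      \<comment> \<open>From 2^(k+1) \<le> 2Q the number of blocks is at most ln (2Q) / ln 2, the
        source of both the logarithm and the ln 2 in the constant.\<close>
      have "real (2 ^ Suc k) \<le> real (2 * Q)" using k by (intro of_nat_mono) simp
      then have "ln ((2::real) ^ Suc k) \<le> ln (2 * real Q)"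
        using \<open>Q > 0\<close> by (subst ln_le_cancel_iff) auto
      then show "real (Suc k) \<le> ln (2 * real Q) / ln 2"
        by (subst (asm) ln_realpow) (simp_all add: field_simps)
    qed (use C XZ in auto)
    finally show ?thesis by (simp add: mult_ac)
  qed
  show "\<exists>C::real. C > 0 \<and>
      (\<forall>(a :: int \<Rightarrow> complex) (Q :: nat) (M :: int) (N :: int). Q > 0 \<longrightarrow> N > 0 \<longrightarrow>
        (\<Sum>q = 1..Q. \<Sum>r\<in>coprime_residues_sq q.
            (cmod (\<Sum>n = M + 1..M + N. a n * e (of_nat r / of_nat (q ^ 2) * of_int n))) ^ 2)
        \<le> C * ln (2 * real Q)
            * (real Q ^ 3
               + (real_of_int N * sqrt (real Q) + sqrt (real_of_int N) * real Q ^ 2)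
                 * real_of_int N powr \<epsilon>)
            * (\<Sum>n = M + 1..M + N. (cmod (a n)) ^ 2))"
    using bound C(1) by (intro exI[of _ "512 * C / ln 2"]) auto
qed

end
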